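(* For every integer $n\geq1$, there do not exist Borel maps $\phi\colon([\omega]^\omega)^{n+1}\to([\omega]^\omega)^n$ and $\psi\colon2^\omega\to2^\omega$ such that for all $(A_1,\ldots,A_{n+1})\in([\omega]^\omega)^{n+1}$ and all $c\in2^\omega$: if $c$ splits every coordinate of $\phi(A_1,\ldots,A_{n+1})$, then $\psi(c)$ splits every one of $A_1,\ldots,A_{n+1}$. (That is, with $\mathfrak s_n$ denoting the Vojtáš triple $(([\omega]^\omega)^n,2^\omega,\mathsf S_n)$ where $(A_1,\ldots,A_n)\mathrel{\mathsf S_n}c$ iff $c$ splits every $A_i$, there is no Borel Tukey morphism from $\mathfrak s_n$ to $\mathfrak s_{n+1}$.)
   Context: $[\omega]^\omega$ is the space of infinite subsets of $\omega$. An element $c\in2^\omega$ splits an infinite set $A\subseteq\omega$ if $c\restriction A$ takes both values $0$ and $1$ infinitely often. A Vojtáš triple is $(A_-,A_+,\mathsf A)$ with $\mathsf A\subseteq A_-\times A_+$; a (Tukey) morphism from $(A_-,A_+,\mathsf A)$ to $(B_-,B_+,\mathsf B)$ is a pair $\phi\colon B_-\to A_-$, $\psi\colon A_+\to B_+$ such that $\phi(b)\mathrel{\mathsf A}a$ implies $b\mathrel{\mathsf B}\psi(a)$ for all $b\in B_-$, $a\in A_+$; it is Borel if $\phi,\psi$ are Borel. *)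

theory Defs
  imports "HOL-Analysis.Analysis"
begin

definition borel_of :: "'a topology \<Rightarrow> 'a measure"
  where "borel_of X = sigma (topspace X) {U. openin X U}"

text \<open>\<open>2\<^sup>\<omega>\<close>, with \<^term>\<open>True\<close> in the role of 1 and \<^term>\<open>False\<close> in the role of 0.\<close>

definition cantor_space :: "(nat \<Rightarrow> bool) topology"
  where "cantor_space = product_topology (\<lambda>_. discrete_topology UNIV) UNIV"

text \<open>\<open>[\<omega>]\<^sup>\<omega>\<close>, topologised as a subspace of \<open>2\<^sup>\<omega>\<close> by identifying sets with their
  characteristic functions.\<close>

definition infinite_sets :: "nat set topology"
  where "infinite_sets = pullback_topology {A. infinite A} (\<lambda>A k. k \<in> A) cantor_space"

text \<open>\<open>([\<omega>]\<^sup>\<omega>)\<^sup>n\<close>: coordinates are indexed by \<open>0, \<dots>, n - 1\<close>, and a tuple is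
  \<^term>\<open>undefined\<close> outside this range.\<close>

definition infinite_sets_power :: "nat \<Rightarrow> (nat \<Rightarrow> nat set) topology"
  where "infinite_sets_power n = product_topology (\<lambda>_. infinite_sets) {..<n}"

definition splits :: "(nat \<Rightarrow> bool) \<Rightarrow> nat set \<Rightarrow> bool"
  where "splits c A \<longleftrightarrow> infinite {k \<in> A. c k} \<and> infinite {k \<in> A. \<not> c k}"

lemma borel_of_euclidean: "borel_of euclidean = borel"
  by (simp add: borel_of_def borel_def)

lemma cantor_space_eq_euclidean: "cantor_space = euclidean"
proof -
  have "discrete_topology UNIV = (euclidean :: bool topology)"
    by (simp add: topology_eq open_discrete)
  then show ?thesis
    by (simp add: cantor_space_def euclidean_product_topology)
qed

lemma topspace_cantor_space [simp]: "topspace cantor_space = UNIV"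
  by (simp add: cantor_space_def)

lemma topspace_infinite_sets [simp]: "topspace infinite_sets = {A. infinite A}"
  by (simp add: infinite_sets_def topspace_pullback_topology)

lemma topspace_infinite_sets_power:
  "topspace (infinite_sets_power n) = {..<n} \<rightarrow>\<^sub>E {A. infinite A}"
  by (simp add: infinite_sets_power_def)

lemma space_borel_of [simp]: "space (borel_of X) = topspace X"
  by (simp add: borel_of_def space_measure_of_conv)

lemma sets_borel_of: "sets (borel_of X) = sigma_sets (topspace X) {U. openin X U}"
  by (auto simp: borel_of_def dest: openin_subset intro!: sets_measure_of)

end

theory Submission
  imports Defs
begin

text \<open>
  Identify infinite sets with their increasing enumerations. By the Galvin--Prikry theorem (Borel sets
  are completely Ramsey) one may restrict to tuples \<open>A\<^sub>0, \<dots>, A\<^sub>n\<close> that are the residue classes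
  modulo \<open>n + 1\<close> of the enumeration \<open>e\<close> of a subset of a fixed infinite set, so that \<open>\<phi>\<close> becomes
  continuous in \<open>e\<close>, and to a family of colourings \<open>c\<^sub>z\<close>, parametrised by infinite sets \<open>z\<close>, on which
  \<open>\<psi>\<close> is continuous and some fixed colour \<open>b\<close> is taken infinitely often by every \<open>\<psi>(c\<^sub>z)\<close>.

  Consider the closed set of all \<open>(z\<^sub>0, \<dots>, z\<^sub>n, e)\<close> such that, for every \<open>j\<close> and
  \<open>z = z\<^sub>j\<close>, \<open>\<psi>(c\<^sub>z)\<close> is constantly \<open>b\<close> on \<open>A\<^sub>j\<close>. On it each \<open>j\<close> has some \<open>i < n\<close> such that the \<open>j\<close>-th colouring is
  eventually constant on the \<open>i\<close>-th coordinate of \<open>\<phi>(A)\<close>. By the Baire category theorem the choices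
  of \<open>i\<close>, of the colour and of the threshold can be made uniform on a nonempty relatively open subset,
  and two indices \<open>j \<noteq> j'\<close> share the same \<open>i\<close>. A basic neighbourhood only fixes initial segments of
  \<open>z\<^sub>j\<close> and \<open>z\<^sub>j\<^sub>'\<close>, so their colourings can still be made equal, or complementary, up to a finite
  set, whichever leaves the \<open>i\<close>-th coordinate of \<open>\<phi>(A)\<close> only finitely many elements.
\<close>

section \<open>Completely Ramsey sets\<close>

text \<open>Unlike in Ellentuck neighbourhoods, \<open>s\<close> need not lie below \<open>Z\<close>; this makes the notion
  trivially stable under translation by finite sets.\<close>

definition completely_ramsey :: "nat set set \<Rightarrow> bool"
  where "completely_ramsey S \<longleftrightarrow>
    (\<forall>s X. finite s \<longrightarrow> infinite X \<longrightarrow>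
      (\<exists>Y\<subseteq>X. infinite Y \<and>
        ((\<forall>Z\<subseteq>Y. infinite Z \<longrightarrow> s \<union> Z \<in> S) \<or> (\<forall>Z\<subseteq>Y. infinite Z \<longrightarrow> s \<union> Z \<notin> S))))"

text \<open>Openness of the infinite members of \<open>S\<close> in the topology inherited from
  Cantor space, not in the finer Ellentuck topology.\<close>

definition ramsey_open :: "nat set set \<Rightarrow> bool"
  where "ramsey_open S \<longleftrightarrow>
    (\<forall>Z. infinite Z \<longrightarrow> Z \<in> S \<longrightarrow>
      (\<exists>N. \<forall>Z'. infinite Z' \<longrightarrow> Z' \<inter> {..<N} = Z \<inter> {..<N} \<longrightarrow> Z' \<in> S))"

section \<open>Thinning infinite sets by diagonalisation\<close>

lemma infinite_Int_greaterThan: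
  fixes X :: "nat set"
  assumes "infinite X"
  shows "infinite (X \<inter> {a<..})"
proof -
  have "X - {..a} = X \<inter> {a<..}" by auto
  then show ?thesis using assms by (metis Diff_infinite_finite finite_atMost)
qed

text \<open>Choose \<open>a\<close> from the reservoir, shrink what lies beyond \<open>a\<close>
  until \<open>Q a\<close> holds, repeat. All later choices come from that reservoir, so heredity
  gives \<open>Q a\<close> for the tail of the resulting set.\<close>

lemma fusion:
  fixes Q :: "nat \<Rightarrow> nat set \<Rightarrow> bool"
  assumes hered: "\<And>a X Y. Q a X \<Longrightarrow> Y \<subseteq> X \<Longrightarrow> infinite Y \<Longrightarrow> Q a Y"
    and dense: "\<And>a X. infinite X \<Longrightarrow> \<exists>Y\<subseteq>X. infinite Y \<and> Q a Y"
    and X: "infinite X"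
  shows "\<exists>Y\<subseteq>X. infinite Y \<and> (\<forall>a\<in>Y. Q a (Y \<inter> {a<..}))"
proof -
  define P where "P = (\<lambda>(_::nat) (p :: nat \<times> nat set). fst p \<in> X \<and> infinite (snd p) \<and> snd p \<subseteq> X
    \<and> snd p \<subseteq> {fst p<..} \<and> Q (fst p) (snd p))"
  define R where "R = (\<lambda>(_::nat) (p :: nat \<times> nat set) (q :: nat \<times> nat set).
    fst q \<in> snd p \<and> snd q \<subseteq> snd p)"
  have step0: "\<exists>q. P r q \<and> fst q \<in> W \<and> snd q \<subseteq> W" if W: "infinite W" "W \<subseteq> X" for W r
  proof -
    obtain a where a: "a \<in> W" using W(1) by (metis finite.emptyI ex_in_conv)
    obtain V where V: "V \<subseteq> W \<inter> {a<..}" "infinite V" "Q a V"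
      using dense[OF infinite_Int_greaterThan[OF W(1)]] by meson
    show ?thesis
      by (rule exI[of _ "(a, V)"]) (use a V W(2) in \<open>auto simp: P_def\<close>)
  qed
  have "\<exists>p. P 0 p" using step0[OF X] by blast
  moreover have "\<exists>q. P (Suc r) q \<and> R r p q" if "P r p" for r p
  proof -
    have "infinite (snd p)" "snd p \<subseteq> X" using that by (auto simp: P_def)
    from step0[OF this] show ?thesis by (auto simp: R_def)
  qed
  ultimately have "\<exists>f. \<forall>r. P r (f r) \<and> R r (f r) (f (Suc r))"
    by (intro dependent_nat_choice) blast+
  then obtain f where f: "\<And>r. P r (f r)" "\<And>r. R r (f r) (f (Suc r))" by blast
  define a where "a r = fst (f r)" for r
  define W where "W r = snd (f r)" for r
  have aX: "a r \<in> X" and infW: "infinite (W r)" and Wgt: "W r \<subseteq> {a r<..}" and QW: "Q (a r) (W r)" for r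
    using f(1)[of r] by (auto simp: P_def a_def W_def)
  have aS: "a (Suc r) \<in> W r" and WS: "W (Suc r) \<subseteq> W r" for r
    using f(2)[of r] by (auto simp: R_def a_def W_def)
  have sm: "strict_mono a"
    using aS Wgt by (intro strict_mono_Suc_iff[THEN iffD2]) auto
  have Wdec: "W r' \<subseteq> W r" if "r \<le> r'" for r r'
    using lift_Suc_antimono_le[of W, OF WS that] .
  have aW: "a r' \<in> W r" if "r < r'" for r r'
    using aS[of "r' - 1"] Wdec[of r "r' - 1"] that by (cases r') auto
  have "Q x (range a \<inter> {x<..})" if x: "x \<in> range a" for x
  proof -
    obtain r where r: "x = a r" using x by blast
    have sub: "range a \<inter> {x<..} \<subseteq> W r"
      using aW sm by (auto simp: r strict_mono_less)
    have "infinite (range a)" using sm by (simp add: range_inj_infinite strict_mono_imp_inj_on)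
    then show ?thesis
      using hered[OF QW sub infinite_Int_greaterThan] by (simp add: r)
  qed
  moreover have "infinite (range a)" using sm by (simp add: range_inj_infinite strict_mono_imp_inj_on)
  ultimately show ?thesis using aX by (intro exI[of _ "range a"]) auto
qed

text \<open>Supplies the density hypothesis of \<open>fusion\<close> when \<open>a\<close> imposes
  finitely many requirements, for instance one for each subset of \<open>{..a}\<close>.\<close>

lemma simultaneous_refinement:
  fixes P :: "'i \<Rightarrow> nat set \<Rightarrow> bool"
  assumes "finite I"
    and hered: "\<And>i X Y. i \<in> I \<Longrightarrow> P i X \<Longrightarrow> Y \<subseteq> X \<Longrightarrow> infinite Y \<Longrightarrow> P i Y"
    and dense: "\<And>i X. i \<in> I \<Longrightarrow> infinite X \<Longrightarrow> \<exists>Y\<subseteq>X. infinite Y \<and> P i Y"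
    and X: "infinite X"
  shows "\<exists>Y\<subseteq>X. infinite Y \<and> (\<forall>i\<in>I. P i Y)"
  using assms(1) hered dense
proof (induction I rule: finite_induct)
  case empty
  then show ?case using X by blast
next
  case (insert i I)
  obtain Y where Y: "Y \<subseteq> X" "infinite Y" "\<forall>i\<in>I. P i Y"
    using insert.IH insert.prems by (metis insertCI)
  obtain Y' where Y': "Y' \<subseteq> Y" "infinite Y'" "P i Y'"
    using insert.prems(2)[of i Y] Y(2) by blast
  have "\<forall>i\<in>I. P i Y'" using insert.prems(1) Y Y' by (metis insertCI)
  then show ?case using Y Y' by (intro exI[of _ Y']) auto
qed

text \<open>Combinatorial forcing: \<open>W\<close> accepts \<open>t\<close> if it forces membership in \<open>S\<close>, and rejects \<open>t\<close> if no
  infinite subset of \<open>W\<close> accepts \<open>t\<close>. A set that rejects \<open>{}\<close> can be thinned out to reject all of its finite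
  subsets, and then openness keeps all of its infinite subsets outside \<open>S\<close>.\<close>

lemma ramsey_open_homogeneous:
  assumes S: "ramsey_open S" and X: "infinite X"
  shows "\<exists>Y\<subseteq>X. infinite Y \<and> ((\<forall>Z\<subseteq>Y. infinite Z \<longrightarrow> Z \<in> S) \<or> (\<forall>Z\<subseteq>Y. infinite Z \<longrightarrow> Z \<notin> S))"
proof -
  define accept where "accept t W \<longleftrightarrow> (\<forall>Z\<subseteq>W. infinite Z \<longrightarrow> t \<union> Z \<in> S)" for t W
  define reject where "reject t W \<longleftrightarrow> (\<forall>V\<subseteq>W. infinite V \<longrightarrow> \<not> accept t V)" for t W
  have acc_mono: "accept t V" if "accept t W" "V \<subseteq> W" for t V W
    using that unfolding accept_def by blast
  have rej_mono: "reject t V" if "reject t W" "V \<subseteq> W" for t V W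
    using that unfolding reject_def by blast
  have rej_tail: "reject t W" if "reject t (W \<inter> {a<..})" for t W a
    unfolding reject_def
  proof (intro allI impI notI)
    fix V assume V: "V \<subseteq> W" "infinite V" "accept t V"
    have "accept t (V \<inter> {a<..})" using V(3) by (rule acc_mono) auto
    then show False using that infinite_Int_greaterThan[OF V(2)] V(1) unfolding reject_def by blast
  qed
  show ?thesis
  proof (cases "reject {} X")
    case False
    then obtain V where "V \<subseteq> X" "infinite V" "accept {} V" unfolding reject_def by blast
    then show ?thesis unfolding accept_def Un_empty_left by blast
  next
    case True
    \<comment> \<open>First fusion: every stem \<open>t\<close> inside \<open>{..a}\<close> is
      decided by the tail beyond \<open>a\<close>.\<close>
    have "\<exists>Y\<subseteq>X. infinite Y \<and> (\<forall>a\<in>Y. \<forall>t\<in>Pow {..a}. accept t (Y \<inter> {a<..}) \<or> reject t (Y \<inter> {a<..}))"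
    proof (rule fusion[OF _ _ X])
      show "\<forall>t\<in>Pow {..a}. accept t Y \<or> reject t Y"
        if "\<forall>t\<in>Pow {..a}. accept t X \<or> reject t X" "Y \<subseteq> X" for a X Y
        using that acc_mono rej_mono by blast
    next
      fix a and W :: "nat set" assume W: "infinite W"
      show "\<exists>Y\<subseteq>W. infinite Y \<and> (\<forall>t\<in>Pow {..a}. accept t Y \<or> reject t Y)"
      proof (rule simultaneous_refinement[OF _ _ _ W])
        show "finite (Pow {..a})" by simp
      next
        fix t :: "nat set" and V V' assume "V' \<subseteq> V" "accept t V \<or> reject t V"
        then show "accept t V' \<or> reject t V'" using acc_mono rej_mono by meson
      next
        fix t and V :: "nat set" assume V: "infinite V"
        show "\<exists>Y\<subseteq>V. infinite Y \<and> (accept t Y \<or> reject t Y)"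
        proof (cases "reject t V")
          case False
          then show ?thesis unfolding reject_def by blast
        qed (use V in blast)
      qed
    qed
    then obtain Y where Y: "Y \<subseteq> X" "infinite Y"
      and dec: "\<And>a t. a \<in> Y \<Longrightarrow> t \<subseteq> {..a} \<Longrightarrow> accept t (Y \<inter> {a<..}) \<or> reject t (Y \<inter> {a<..})"
      by blast
    \<comment> \<open>Otherwise the infinitely many such \<open>k\<close> beyond \<open>t\<close>
      form a set \<open>K\<close> that accepts \<open>t\<close>: if \<open>Z\<close> inside
      \<open>K\<close> has least element \<open>k\<close>, the tail of \<open>Y\<close> beyond
      \<open>k\<close> decides \<open>insert k t\<close> without rejecting it, hence accepts
      it.\<close>
    have bad: "finite {k\<in>Y. \<not> reject (insert k t) Y}" if t: "finite t" and rej: "reject t Y" for t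
    proof (rule ccontr)
      assume inf: "infinite {k\<in>Y. \<not> reject (insert k t) Y}"
      obtain b where b: "t \<subseteq> {..b}" using t finite_nat_iff_bounded_le by blast
      define K where "K = {k\<in>Y. \<not> reject (insert k t) Y} \<inter> {b<..}"
      have infK: "infinite K" unfolding K_def by (rule infinite_Int_greaterThan[OF inf])
      have "accept t K"
        unfolding accept_def
      proof (intro allI impI)
        fix Z assume Z: "Z \<subseteq> K" "infinite Z"
        define k where "k = (LEAST k. k \<in> Z)"
        have k: "k \<in> Z" using Z(2) unfolding k_def by (metis LeastI ex_in_conv finite.emptyI)
        have le: "k \<le> x" if "x \<in> Z" for x using that unfolding k_def by (rule Least_le)
        have kK: "k \<in> Y" "\<not> reject (insert k t) Y" "b < k" using k Z(1) by (auto simp: K_def)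
        have "insert k t \<subseteq> {..k}" using b kK(3) by auto
        then have acc: "accept (insert k t) (Y \<inter> {k<..})"
          using dec[OF kK(1)] rej_tail kK(2) by blast
        have "Z \<inter> {k<..} \<subseteq> Y \<inter> {k<..}" using Z(1) by (auto simp: K_def)
        then have "insert k t \<union> (Z \<inter> {k<..}) \<in> S"
          using acc infinite_Int_greaterThan[OF Z(2)] unfolding accept_def by blast
        moreover have "insert k t \<union> (Z \<inter> {k<..}) = t \<union> Z"
          using k le by (auto simp: nat_less_le)
        ultimately show "t \<union> Z \<in> S" by simp
      qed
      moreover have "K \<subseteq> Y" by (auto simp: K_def)
      ultimately show False using rej infK unfolding reject_def by blast
    qed
    \<comment> \<open>Second fusion: with \<open>a\<close>, the finitely many exceptional
      \<open>k\<close> of all rejected stems inside \<open>{..a}\<close> are discarded. Fusion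
      ranges over arbitrary infinite sets, whereas \<open>bad\<close> only concerns \<open>k\<close>
      in \<open>Y\<close>; hence the intersection with \<open>Y\<close>.\<close>
    have "\<exists>Y'\<subseteq>Y. infinite Y' \<and> (\<forall>a\<in>Y'. \<forall>t\<in>Pow {..a}. reject t Y \<longrightarrow>
        (\<forall>k\<in>(Y' \<inter> {a<..}) \<inter> Y. reject (insert k t) Y))"
    proof (rule fusion[OF _ _ Y(2)])
      fix a and W :: "nat set" assume W: "infinite W"
      let ?B = "\<Union>t\<in>{t\<in>Pow {..a}. reject t Y}. {k\<in>Y. \<not> reject (insert k t) Y}"
      have "finite ?B"
      proof (rule finite_UN_I)
        fix t assume "t \<in> {t \<in> Pow {..a}. reject t Y}"
        then have "finite t" "reject t Y" by (auto intro: finite_subset[of _ "{..a}"])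
        then show "finite {k \<in> Y. \<not> reject (insert k t) Y}" by (rule bad)
      qed simp
      then have "infinite (W - ?B)" using W by (rule Diff_infinite_finite)
      then show "\<exists>Y'\<subseteq>W. infinite Y' \<and> (\<forall>t\<in>Pow {..a}. reject t Y \<longrightarrow> (\<forall>k\<in>Y' \<inter> Y. reject (insert k t) Y))"
        by (intro exI[of _ "W - ?B"]) blast
    qed blast
    then obtain Y' where Y': "Y' \<subseteq> Y" "infinite Y'"
      and rejS: "\<And>a t k. a \<in> Y' \<Longrightarrow> t \<subseteq> {..a} \<Longrightarrow> reject t Y \<Longrightarrow> k \<in> Y' \<Longrightarrow> a < k \<Longrightarrow> reject (insert k t) Y"
      by blast
    obtain a0 where a0: "a0 \<in> Y'" using Y'(2) by (metis finite.emptyI ex_in_conv)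
    \<comment> \<open>Dropping everything up to \<open>a0\<close> gives even the empty stem a bound
      in \<open>Y'\<close>, so \<open>rejS\<close> applies from the start of the induction.\<close>
    define Y3 where "Y3 = Y' \<inter> {a0<..}"
    have inf3: "infinite Y3" unfolding Y3_def by (rule infinite_Int_greaterThan[OF Y'(2)])
    have rej: "reject t Y" if "finite t" "t \<subseteq> Y3" for t
      using that
    proof (induction t rule: finite_linorder_max_induct)
      case empty
      then show ?case using True Y(1) rej_mono by blast
    next
      case (insert b A)
      define a where "a = Max (Set.insert a0 A)"
      have "a \<in> Set.insert a0 A" unfolding a_def using insert.hyps by (intro Max_in) auto
      then have "a \<in> Y'" "a < b" using insert a0 by (auto simp: Y3_def)
      moreover have "A \<subseteq> {..a}" unfolding a_def using insert.hyps by auto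
      ultimately show ?case using rejS insert by (auto simp: Y3_def)
    qed
    have "Z \<notin> S" if Z: "Z \<subseteq> Y3" "infinite Z" for Z
    proof
      assume "Z \<in> S"
      then obtain N where N: "\<And>Z'. infinite Z' \<Longrightarrow> Z' \<inter> {..<N} = Z \<inter> {..<N} \<Longrightarrow> Z' \<in> S"
        using S Z(2) unfolding ramsey_open_def by blast
      \<comment> \<open>Elements beyond \<open>N\<close> leave the part below \<open>N\<close>
        unchanged, so openness makes the tail of \<open>Y3\<close> accept a stem that
        \<open>Y\<close> rejects.\<close>
      have "accept (Z \<inter> {..<N}) (Y3 \<inter> {N<..})"
        unfolding accept_def by (intro allI impI N) auto
      moreover have "infinite (Y3 \<inter> {N<..})" by (rule infinite_Int_greaterThan[OF inf3])
      moreover have "Y3 \<inter> {N<..} \<subseteq> Y" using Y'(1) by (auto simp: Y3_def)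
      ultimately show False using rej[of "Z \<inter> {..<N}"] Z(1) unfolding reject_def by auto
    qed
    moreover have "Y3 \<subseteq> X" using Y(1) Y'(1) by (auto simp: Y3_def)
    ultimately show ?thesis using inf3 by (intro exI[of _ Y3]) auto
  qed
qed

section \<open>Continuity and closure properties of completely Ramsey sets\<close>

lemma ramsey_open_translate:
  assumes "ramsey_open S"
  shows "ramsey_open {Z. s \<union> Z \<in> S}"
  unfolding ramsey_open_def
proof (intro allI impI)
  fix Z assume "infinite Z" "Z \<in> {Z. s \<union> Z \<in> S}"
  then obtain N where N: "\<And>Z'. infinite Z' \<Longrightarrow> Z' \<inter> {..<N} = (s \<union> Z) \<inter> {..<N} \<Longrightarrow> Z' \<in> S"
    using assms unfolding ramsey_open_def by (metis finite_Un mem_Collect_eq)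
  show "\<exists>N. \<forall>Z'. infinite Z' \<longrightarrow> Z' \<inter> {..<N} = Z \<inter> {..<N} \<longrightarrow> Z' \<in> {Z. s \<union> Z \<in> S}"
    using N by (intro exI[of _ N]) (auto simp: Int_Un_distrib2)
qed

lemma completely_ramsey_open:
  assumes "ramsey_open S"
  shows "completely_ramsey S"
  unfolding completely_ramsey_def
  using ramsey_open_homogeneous[OF ramsey_open_translate[OF assms]] by auto

lemma completely_ramsey_translate:
  assumes "completely_ramsey S" "finite s"
  shows "completely_ramsey {Z. s \<union> Z \<in> S}"
  unfolding completely_ramsey_def
proof (intro allI impI)
  fix t X assume "finite (t::nat set)" "infinite (X::nat set)"
  then show "\<exists>Y\<subseteq>X. infinite Y \<and> ((\<forall>Z\<subseteq>Y. infinite Z \<longrightarrow> t \<union> Z \<in> {Z. s \<union> Z \<in> S}) \<or>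
      (\<forall>Z\<subseteq>Y. infinite Z \<longrightarrow> t \<union> Z \<notin> {Z. s \<union> Z \<in> S}))"
    using assms(1)[unfolded completely_ramsey_def, rule_format, of "s \<union> t" X] assms(2)
    by (simp add: Un_assoc)
qed

text \<open>With \<open>a\<close>, fusion handles the finitely many pairs of an index up to
  \<open>a\<close> and a stem inside \<open>{..a}\<close>. Countably many completely Ramsey
  conditions thereby become continuous on the subsets of one \<open>Y\<close>; this serves for
  countable unions and for Borel maps alike.\<close>

lemma completely_ramsey_continuity:
  assumes S: "\<And>n::nat. completely_ramsey (S n)" and X: "infinite X"
  shows "\<exists>Y\<subseteq>X. infinite Y \<and> (\<forall>n. \<exists>N. \<forall>Z Z'. Z \<subseteq> Y \<longrightarrow> Z' \<subseteq> Y \<longrightarrow> infinite Z \<longrightarrow> infinite Z' \<longrightarrow>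
    Z \<inter> {..<N} = Z' \<inter> {..<N} \<longrightarrow> (Z \<in> S n \<longleftrightarrow> Z' \<in> S n))"
proof -
  define dec where "dec p W \<longleftrightarrow> (\<forall>Z\<subseteq>W. infinite Z \<longrightarrow> snd p \<union> Z \<in> S (fst p)) \<or>
    (\<forall>Z\<subseteq>W. infinite Z \<longrightarrow> snd p \<union> Z \<notin> S (fst p))" for p W
  have mono: "dec p V" if "dec p W" "V \<subseteq> W" for p V W
    using that unfolding dec_def by (meson subset_trans)
  have "\<exists>Y\<subseteq>X. infinite Y \<and> (\<forall>a\<in>Y. \<forall>p\<in>{..a} \<times> Pow {..a}. dec p (Y \<inter> {a<..}))"
  proof (rule fusion[OF _ _ X])
    fix a and W :: "nat set" assume W: "infinite W"
    show "\<exists>Y\<subseteq>W. infinite Y \<and> (\<forall>p\<in>{..a} \<times> Pow {..a}. dec p Y)"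
    proof (rule simultaneous_refinement[OF _ _ _ W])
      fix p and V :: "nat set" assume p: "p \<in> {..a} \<times> Pow {..a}" and V: "infinite V"
      have "finite (snd p)" using p by (auto intro: finite_subset[of _ "{..a}"])
      then show "\<exists>Y\<subseteq>V. infinite Y \<and> dec p Y"
        using S[of "fst p", unfolded completely_ramsey_def] V unfolding dec_def by blast
    qed (use mono in auto)
  qed (use mono in blast)
  then obtain Y where Y: "Y \<subseteq> X" "infinite Y"
    and D: "\<And>a p. a \<in> Y \<Longrightarrow> p \<in> {..a} \<times> Pow {..a} \<Longrightarrow> dec p (Y \<inter> {a<..})" by meson
  have "\<exists>N. \<forall>Z Z'. Z \<subseteq> Y \<longrightarrow> Z' \<subseteq> Y \<longrightarrow> infinite Z \<longrightarrow> infinite Z' \<longrightarrow>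
    Z \<inter> {..<N} = Z' \<inter> {..<N} \<longrightarrow> (Z \<in> S n \<longleftrightarrow> Z' \<in> S n)" for n
  proof -
    obtain a where a: "a \<in> Y" "n \<le> a" using Y(2) by (metis infinite_nat_iff_unbounded_le)
    show ?thesis
    proof (intro exI[of _ "Suc a"] allI impI)
      fix Z Z' assume Z: "Z \<subseteq> Y" "Z' \<subseteq> Y" "infinite Z" "infinite Z'" "Z \<inter> {..<Suc a} = Z' \<inter> {..<Suc a}"
      let ?t = "Z \<inter> {..<Suc a}"
      have UN: "{..<Suc a} \<union> {a<..} = UNIV" by auto
      have eq: "Z = ?t \<union> (Z \<inter> {a<..})" "Z' = ?t \<union> (Z' \<inter> {a<..})"
        using Z(5) UN by (metis Int_Un_distrib Int_UNIV_right)+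
      have "dec (n, ?t) (Y \<inter> {a<..})" using a by (intro D) auto
      moreover have "Z \<inter> {a<..} \<subseteq> Y \<inter> {a<..}" "Z' \<inter> {a<..} \<subseteq> Y \<inter> {a<..}" using Z by auto
      moreover note infinite_Int_greaterThan[OF Z(3), of a] infinite_Int_greaterThan[OF Z(4), of a]
      ultimately have "?t \<union> (Z \<inter> {a<..}) \<in> S n \<longleftrightarrow> ?t \<union> (Z' \<inter> {a<..}) \<in> S n"
        unfolding dec_def fst_conv snd_conv by blast
      then show "Z \<in> S n \<longleftrightarrow> Z' \<in> S n" by (simp flip: eq)
    qed
  qed
  then show ?thesis using Y by blast
qed

text \<open>The stem is absorbed into the predicates; a first thinning makes the union relatively
  open, a second one makes it homogeneous.\<close>

lemma completely_ramsey_ex: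
  assumes "\<And>n::nat. completely_ramsey {Z. P n Z}"
  shows "completely_ramsey {Z. \<exists>n. P n Z}"
  unfolding completely_ramsey_def
proof (intro allI impI)
  fix s X :: "nat set" assume s: "finite s" and X: "infinite X"
  have "completely_ramsey {Z. P n (s \<union> Z)}" for n
    using completely_ramsey_translate[OF assms s, of n] by simp
  from completely_ramsey_continuity[of "\<lambda>n. {Z. P n (s \<union> Z)}", OF this X]
  obtain Y where Y: "Y \<subseteq> X" "infinite Y"
    and C: "\<And>n. \<exists>N. \<forall>Z Z'. Z \<subseteq> Y \<longrightarrow> Z' \<subseteq> Y \<longrightarrow> infinite Z \<longrightarrow> infinite Z' \<longrightarrow>
      Z \<inter> {..<N} = Z' \<inter> {..<N} \<longrightarrow> (P n (s \<union> Z) \<longleftrightarrow> P n (s \<union> Z'))"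
    unfolding mem_Collect_eq by blast
  \<comment> \<open>On subsets of \<open>Y\<close> every \<open>P n\<close> is clopen, so the union is open.\<close>
  define T where "T = {Z. \<exists>N. \<forall>Z'\<subseteq>Y. infinite Z' \<longrightarrow> Z' \<inter> {..<N} = Z \<inter> {..<N} \<longrightarrow> (\<exists>n. P n (s \<union> Z'))}"
  have T_open: "ramsey_open T"
    unfolding ramsey_open_def
  proof (intro allI impI)
    fix Z assume "Z \<in> T"
    then obtain N where "\<forall>Z'\<subseteq>Y. infinite Z' \<longrightarrow> Z' \<inter> {..<N} = Z \<inter> {..<N} \<longrightarrow> (\<exists>n. P n (s \<union> Z'))"
      unfolding T_def by blast
    then show "\<exists>N. \<forall>Z'. infinite Z' \<longrightarrow> Z' \<inter> {..<N} = Z \<inter> {..<N} \<longrightarrow> Z' \<in> T"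
      unfolding T_def mem_Collect_eq by metis
  qed
  have T_iff: "Z \<in> T \<longleftrightarrow> (\<exists>n. P n (s \<union> Z))" if Z: "Z \<subseteq> Y" "infinite Z" for Z
  proof
    assume "Z \<in> T" then show "\<exists>n. P n (s \<union> Z)" using Z unfolding T_def by blast
  next
    assume "\<exists>n. P n (s \<union> Z)"
    then obtain n where n: "P n (s \<union> Z)" ..
    obtain N where "\<forall>Z Z'. Z \<subseteq> Y \<longrightarrow> Z' \<subseteq> Y \<longrightarrow> infinite Z \<longrightarrow> infinite Z' \<longrightarrow>
      Z \<inter> {..<N} = Z' \<inter> {..<N} \<longrightarrow> (P n (s \<union> Z) \<longleftrightarrow> P n (s \<union> Z'))" using C by blast
    then show "Z \<in> T" using n Z unfolding T_def by blast
  qed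
  obtain V where V: "V \<subseteq> Y" "infinite V"
    and hom: "(\<forall>Z\<subseteq>V. infinite Z \<longrightarrow> Z \<in> T) \<or> (\<forall>Z\<subseteq>V. infinite Z \<longrightarrow> Z \<notin> T)"
    using ramsey_open_homogeneous[OF T_open Y(2)] by blast
  have eq: "s \<union> Z \<in> {Z. \<exists>n. P n Z} \<longleftrightarrow> Z \<in> T" if "Z \<subseteq> V" "infinite Z" for Z
    using T_iff[of Z] that V(1) by simp
  have "(\<forall>Z\<subseteq>V. infinite Z \<longrightarrow> s \<union> Z \<in> {Z. \<exists>n. P n Z}) \<or>
      (\<forall>Z\<subseteq>V. infinite Z \<longrightarrow> s \<union> Z \<notin> {Z. \<exists>n. P n Z})"
    using hom eq by (simp cong: conj_cong)
  then show "\<exists>Y\<subseteq>X. infinite Y \<and> ((\<forall>Z\<subseteq>Y. infinite Z \<longrightarrow> s \<union> Z \<in> {Z. \<exists>n. P n Z}) \<or>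
      (\<forall>Z\<subseteq>Y. infinite Z \<longrightarrow> s \<union> Z \<notin> {Z. \<exists>n. P n Z}))"
    using V Y(1) by (meson subset_trans)
qed

lemma completely_ramsey_not:
  assumes "completely_ramsey {Z. P Z}"
  shows "completely_ramsey {Z. \<not> P Z}"
  using assms unfolding completely_ramsey_def mem_Collect_eq not_not by (metis (no_types))

lemma completely_ramsey_all:
  assumes "\<And>n::nat. completely_ramsey {Z. P n Z}"
  shows "completely_ramsey {Z. \<forall>n. P n Z}"
  using completely_ramsey_not[OF completely_ramsey_ex[OF completely_ramsey_not[OF assms]]] by simp

lemma completely_ramsey_cong:
  assumes "\<And>Z. infinite Z \<Longrightarrow> Z \<in> S \<longleftrightarrow> Z \<in> T"
  shows "completely_ramsey S \<longleftrightarrow> completely_ramsey T"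
  unfolding completely_ramsey_def by (simp add: assms)

section \<open>The category argument\<close>

text \<open>The Baire category theorem for a closed set of sequences over a discrete space. If no
  box of \<open>P\<close> lay in one \<open>K r\<close>, prefixes could be lengthened inside
  \<open>P\<close> to escape \<open>K 0\<close>, \<open>K 1\<close>, ... in turn, with a limit in
  \<open>P\<close> outside all of them.\<close>

lemma sequence_space_Baire:
  fixes P :: "(nat \<Rightarrow> 'b) set" and K :: "nat \<Rightarrow> (nat \<Rightarrow> 'b) set"
  assumes closed_P: "\<And>x. (\<And>N. \<exists>y\<in>P. \<forall>l<N. y l = x l) \<Longrightarrow> x \<in> P"
    and closed_K: "\<And>r x. (\<And>N. \<exists>y\<in>K r. \<forall>l<N. y l = x l) \<Longrightarrow> x \<in> K r"
    and nonempty: "P \<noteq> {}" and cover: "P \<subseteq> (\<Union>r. K r)"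
  shows "\<exists>x\<in>P. \<exists>N r. \<forall>y\<in>P. (\<forall>l<N. y l = x l) \<longrightarrow> y \<in> K r"
proof (rule ccontr)
  assume neg: "\<not> ?thesis"
  define R where "R = (\<lambda>r (p :: (nat \<Rightarrow> 'b) \<times> nat) (q :: (nat \<Rightarrow> 'b) \<times> nat).
    (\<forall>l<snd p. fst q l = fst p l) \<and> snd p < snd q \<and> (\<forall>z. (\<forall>l<snd q. z l = fst q l) \<longrightarrow> z \<notin> K r))"
  have "\<exists>q. fst q \<in> P \<and> R r p q" if p: "fst p \<in> P" for p r
  proof -
    obtain y where y: "y \<in> P" "\<forall>l<snd p. y l = fst p l" "y \<notin> K r"
      using neg p by blast
    obtain N where N: "\<And>z. z \<in> K r \<Longrightarrow> \<not> (\<forall>l<N. z l = y l)"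
      using closed_K[of r y] y(3) by blast
    show ?thesis
      by (rule exI[of _ "(y, max N (Suc (snd p)))"]) (use y N in \<open>force simp: R_def\<close>)
  qed
  moreover have "\<exists>p. fst p \<in> P" for p :: "(nat \<Rightarrow> 'b) \<times> nat" using nonempty by auto
  ultimately have "\<exists>f. \<forall>r. fst (f r) \<in> P \<and> R r (f r) (f (Suc r))"
    by (intro dependent_nat_choice) auto
  then obtain f where f: "\<And>r. fst (f r) \<in> P" "\<And>r. R r (f r) (f (Suc r))" by blast
  define x where "x r = fst (f r)" for r
  define M where "M r = snd (f r)" for r
  have xP: "x r \<in> P" for r using f(1) by (simp add: x_def)
  have agree: "x (Suc r) l = x r l" if "l < M r" for r l using f(2)[of r] that by (auto simp: R_def x_def M_def)
  have MS: "M r < M (Suc r)" for r using f(2)[of r] by (auto simp: R_def M_def)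
  have avoid: "z \<notin> K r" if "\<And>l. l < M (Suc r) \<Longrightarrow> z l = x (Suc r) l" for r z
    using f(2)[of r] that by (auto simp: R_def x_def M_def)
  have sM: "strict_mono M" using MS by (simp add: strict_mono_Suc_iff)
  then have Mge: "r \<le> M r" for r by (rule strict_mono_imp_increasing)
  have stable: "x r' l = x r l" if "r \<le> r'" "l < M r" for r r' l
    using that(1)
  proof (induction r' rule: dec_induct)
    case (step m)
    have "M r \<le> M m" using sM step.hyps(1) by (simp add: strict_mono_less_eq)
    then show ?case using agree[of l m] that(2) step.IH by simp
  qed simp
  \<comment> \<open>Coordinate \<open>l\<close> is frozen from stage \<open>Suc l\<close> on,
    because \<open>l < M (Suc l)\<close>.\<close>
  define z where "z l = x (Suc l) l" for l
  have zx: "z l = x r l" if "l < M r" for l r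
  proof (cases "r \<le> Suc l")
    case True
    then show ?thesis using stable that by (simp add: z_def)
  next
    case False
    then show ?thesis using stable[of "Suc l" r l] Mge[of "Suc l"] by (simp add: z_def)
  qed
  have "z \<in> P"
    by (rule closed_P) (use xP zx Mge in \<open>metis order.strict_trans2\<close>)
  then obtain r where "z \<in> K r" using cover by blast
  then show False using avoid zx by blast
qed

lemma strict_mono_extension:
  fixes e :: "nat \<Rightarrow> nat"
  assumes e: "strict_mono e" and V: "\<And>l. infinite (V l :: nat set)"
  shows "\<exists>e'. strict_mono e' \<and> (\<forall>l<N. e' l = e l) \<and> (\<forall>l\<ge>N. e' l \<in> V l)"
proof -
  define Q where "Q l v \<longleftrightarrow> (l < N \<longrightarrow> v = e l) \<and> (N \<le> l \<longrightarrow> v \<in> V l)" for l v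
  have "\<exists>v. Q 0 v" unfolding Q_def using V by (metis finite.emptyI ex_in_conv not_le)
  moreover have "\<exists>w. Q (Suc l) w \<and> v < w" if "Q l v" for l v
  proof (cases "Suc l < N")
    case True
    then show ?thesis using that e by (auto simp: Q_def strict_mono_def)
  next
    case False
    then show ?thesis using V[of "Suc l"] by (auto simp: Q_def infinite_nat_iff_unbounded)
  qed
  ultimately have "\<exists>f. \<forall>l. Q l (f l) \<and> f l < f (Suc l)"
    by (intro dependent_nat_choice) auto
  then show ?thesis unfolding Q_def strict_mono_Suc_iff by blast
qed

text \<open>The contradiction for continuous data: \<open>X z\<close> stands for the positions where
  the image of the colouring \<open>c z\<close> takes the fixed colour, and \<open>unsplit\<close>
  is the contrapositive of the morphism property. By \<open>clash\<close>, prefixes never prevent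
  two colourings from avoiding a prescribed pair of colours almost everywhere.\<close>

lemma no_continuous_splitting:
  fixes n :: nat and C :: "(nat \<Rightarrow> nat) \<Rightarrow> nat \<Rightarrow> nat set" and c :: "(nat \<Rightarrow> nat) \<Rightarrow> nat \<Rightarrow> bool"
    and X :: "(nat \<Rightarrow> nat) \<Rightarrow> nat set"
  assumes C_inf: "\<And>e i. strict_mono e \<Longrightarrow> i < n \<Longrightarrow> infinite (C e i)"
    and C_cont: "\<And>e i k. strict_mono e \<Longrightarrow> i < n \<Longrightarrow> k \<in> C e i \<Longrightarrow>
      \<exists>N. \<forall>e'. strict_mono e' \<longrightarrow> (\<forall>l<N. e' l = e l) \<longrightarrow> k \<in> C e' i"
    and c_cont: "\<And>z k. strict_mono z \<Longrightarrow>
      \<exists>N. \<forall>z'. strict_mono z' \<longrightarrow> (\<forall>l<N. z' l = z l) \<longrightarrow> c z' k = c z k"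
    and X_inf: "\<And>z. strict_mono z \<Longrightarrow> infinite (X z)"
    and X_cont: "\<And>z m. strict_mono z \<Longrightarrow>
      \<exists>N. \<forall>z'. strict_mono z' \<longrightarrow> (\<forall>l<N. z' l = z l) \<longrightarrow> (m \<in> X z' \<longleftrightarrow> m \<in> X z)"
    and unsplit: "\<And>z e j. strict_mono z \<Longrightarrow> strict_mono e \<Longrightarrow> j \<le> n \<Longrightarrow>
      (\<And>l. l mod Suc n = j \<Longrightarrow> e l \<in> X z) \<Longrightarrow> \<exists>i<n. \<not> splits (c z) (C e i)"
    and clash: "\<And>z z' N v v'. strict_mono z \<Longrightarrow> strict_mono z' \<Longrightarrow>
      \<exists>w w'. strict_mono w \<and> strict_mono w' \<and> (\<forall>l<N. w l = z l) \<and> (\<forall>l<N. w' l = z' l) \<and>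
        finite {k. c w k = v \<and> c w' k = v'}"
  shows False
proof -
  \<comment> \<open>A point \<open>x\<close> lists at \<open>l\<close> the \<open>l\<close>-th
    values of all sequences \<open>Z j x\<close> and of \<open>E x\<close>, so one prefix of
    \<open>x\<close> fixes prefixes of them all.\<close>
  define Z where "Z j x = (\<lambda>l. fst (x l) j)" for j and x :: "nat \<Rightarrow> (nat \<Rightarrow> nat) \<times> nat"
  define E where "E x = (\<lambda>l. snd (x l))" for x :: "nat \<Rightarrow> (nat \<Rightarrow> nat) \<times> nat"
  define P where "P = {x. (\<forall>j. strict_mono (Z j x)) \<and> strict_mono (E x) \<and>
    (\<forall>l. E x l \<in> X (Z (l mod Suc n) x))}"
  \<comment> \<open>Entry \<open>j\<close> of the label \<open>L\<close> is a triple
    \<open>(i, v, M)\<close>: the \<open>j\<close>-th colouring is constantly \<open>v\<close> on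
    the \<open>i\<close>-th set from \<open>M\<close> on.\<close>
  define F where "F L = {x \<in> P. length L = Suc n \<and> (\<forall>j\<le>n. \<forall>k\<ge>snd (snd (L ! j)). fst (L ! j) < n \<and>
    (k \<in> C (E x) (fst (L ! j)) \<longrightarrow> c (Z j x) k = fst (snd (L ! j))))}"
    for L :: "(nat \<times> bool \<times> nat) list"
  have agree_Z: "\<forall>l<N. Z j y l = Z j x l" if "\<forall>l<N. y l = x l" for x y N j
    using that by (simp add: Z_def)
  have agree_E: "\<forall>l<N. E y l = E x l" if "\<forall>l<N. y l = x l" for x y N
    using that by (simp add: E_def)
  have closed_P: "x \<in> P" if lim: "\<And>N. \<exists>y\<in>P. \<forall>l<N. y l = x l" for x
  proof -
    have sZ: "strict_mono (Z j x)" for j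
      unfolding strict_mono_Suc_iff
    proof
      fix l
      obtain y where y: "y \<in> P" "\<forall>i<Suc (Suc l). y i = x i" using lim by blast
      then have "Z j y l < Z j y (Suc l)" by (auto simp: P_def strict_mono_def)
      then show "Z j x l < Z j x (Suc l)" using y(2) by (simp add: Z_def)
    qed
    have sE: "strict_mono (E x)"
      unfolding strict_mono_Suc_iff
    proof
      fix l
      obtain y where y: "y \<in> P" "\<forall>i<Suc (Suc l). y i = x i" using lim by blast
      then have "E y l < E y (Suc l)" by (auto simp: P_def strict_mono_def)
      then show "E x l < E x (Suc l)" using y(2) by (simp add: E_def)
    qed
    have "E x l \<in> X (Z (l mod Suc n) x)" for l
    proof -
      let ?j = "l mod Suc n"
      obtain N where N: "\<And>z'. strict_mono z' \<Longrightarrow> (\<forall>l<N. z' l = Z ?j x l) \<Longrightarrow>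
          (E x l \<in> X z' \<longleftrightarrow> E x l \<in> X (Z ?j x))"
        using X_cont[OF sZ] by meson
      obtain y where y: "y \<in> P" "\<forall>i<max N (Suc l). y i = x i" using lim by blast
      have "E y l \<in> X (Z ?j y)" "strict_mono (Z ?j y)" using y(1) by (auto simp: P_def)
      moreover have "E y l = E x l" using y(2) by (simp add: E_def)
      moreover have "\<forall>l<N. Z ?j y l = Z ?j x l" using y(2) by (simp add: Z_def)
      ultimately show ?thesis using N by metis
    qed
    then show ?thesis using sZ sE by (simp add: P_def)
  qed
  have F_sub: "F L \<subseteq> P" for L by (auto simp: F_def)
  have closed_F: "x \<in> F L" if lim: "\<And>N. \<exists>y\<in>F L. \<forall>l<N. y l = x l" for L x
  proof -
    have "x \<in> P" by (rule closed_P) (use lim F_sub in blast)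
    then have sZ: "\<And>j. strict_mono (Z j x)" and sE: "strict_mono (E x)" by (auto simp: P_def)
    have len: "length L = Suc n" using lim[of 0] by (auto simp: F_def)
    have i: "fst (L ! j) < n" if "j \<le> n" for j using lim[of 0] that by (auto simp: F_def)
    \<comment> \<open>Some \<open>y\<close> in \<open>F L\<close> is so close to \<open>x\<close>
      that \<open>k\<close> is still in the set and keeps its colour; the label thus constrains
      \<open>x\<close> as well.\<close>
    have "c (Z j x) k = fst (snd (L ! j))"
      if j: "j \<le> n" and k: "snd (snd (L ! j)) \<le> k" and kC: "k \<in> C (E x) (fst (L ! j))" for j k
    proof -
      obtain N where N: "\<And>e'. strict_mono e' \<Longrightarrow> (\<forall>l<N. e' l = E x l) \<Longrightarrow> k \<in> C e' (fst (L ! j))"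
        using C_cont[OF sE i[OF j] kC] by blast
      obtain M where M: "\<And>z'. strict_mono z' \<Longrightarrow> (\<forall>l<M. z' l = Z j x l) \<Longrightarrow> c z' k = c (Z j x) k"
        using c_cont[OF sZ] by blast
      obtain y where y: "y \<in> F L" "\<forall>l<max N M. y l = x l" using lim by blast
      then have yP: "strict_mono (E y)" "strict_mono (Z j y)" by (auto simp: F_def P_def)
      have "k \<in> C (E y) (fst (L ! j))" using y(2) by (intro N yP) (simp add: E_def)
      moreover have "c (Z j y) k = c (Z j x) k" using y(2) by (intro M yP) (simp add: Z_def)
      ultimately show ?thesis using y(1) j k by (auto simp: F_def)
    qed
    then show ?thesis using \<open>x \<in> P\<close> len i by (auto simp: F_def)
  qed
  have nonempty: "P \<noteq> {}"
  proof -
    have id: "strict_mono (\<lambda>l::nat. l)" by (simp add: strict_mono_def)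
    have "\<exists>e. strict_mono e \<and> (\<forall>l::nat. e l \<in> X (\<lambda>l. l))"
      using strict_mono_extension[OF id, of "\<lambda>_. X (\<lambda>l. l)" 0] X_inf[OF id] by simp
    then obtain e where e: "strict_mono e" "\<forall>l::nat. e l \<in> X (\<lambda>l. l)" by blast
    have "(\<lambda>l. (\<lambda>_. l, e l)) \<in> P" using e id by (simp add: P_def Z_def E_def)
    then show ?thesis by blast
  qed
  have cover: "\<exists>L. x \<in> F L" if x: "x \<in> P" for x
  proof -
    have sZ: "\<And>j. strict_mono (Z j x)" and sE: "strict_mono (E x)"
      and inX: "\<And>l. E x l \<in> X (Z (l mod Suc n) x)" using x by (auto simp: P_def)
    have "\<exists>p. fst p < n \<and> (\<forall>k\<ge>snd (snd p). k \<in> C (E x) (fst p) \<longrightarrow> c (Z j x) k = fst (snd p))"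
      if j: "j \<le> n" for j
    proof -
      obtain i where i: "i < n" "\<not> splits (c (Z j x)) (C (E x) i)"
        using unsplit[OF sZ sE j] inX by metis
      then have "finite {k \<in> C (E x) i. c (Z j x) k \<noteq> False} \<or> finite {k \<in> C (E x) i. c (Z j x) k \<noteq> True}"
        by (simp add: splits_def)
      then obtain v where "finite {k \<in> C (E x) i. c (Z j x) k \<noteq> v}" by blast
      then obtain M where M: "\<forall>k\<in>{k \<in> C (E x) i. c (Z j x) k \<noteq> v}. k < M"
        unfolding finite_nat_set_iff_bounded by blast
      then show ?thesis using i by (intro exI[of _ "(i, v, M)"]) (auto simp: not_le[symmetric])
    qed
    then obtain g where g: "\<And>j. j \<le> n \<Longrightarrow> fst (g j) < n \<and>
        (\<forall>k\<ge>snd (snd (g j)). k \<in> C (E x) (fst (g j)) \<longrightarrow> c (Z j x) k = fst (snd (g j)))" by metis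
    have "x \<in> F (map g [0..<Suc n])"
      unfolding F_def mem_Collect_eq
    proof (intro conjI allI impI x)
      fix j k assume j: "j \<le> n"
      have eq: "map g [0..<Suc n] ! j = g j" using j by (simp del: upt_Suc)
      show "fst (map g [0..<Suc n] ! j) < n" unfolding eq using g[OF j] by blast
      assume "snd (snd (map g [0..<Suc n] ! j)) \<le> k" "k \<in> C (E x) (fst (map g [0..<Suc n] ! j))"
      then show "c (Z j x) k = fst (snd (map g [0..<Suc n] ! j))" unfolding eq using g[OF j] by blast
    qed simp
    then show ?thesis by blast
  qed
  \<comment> \<open>Labels form a countable type, so \<open>from_nat\<close> arranges the cover in a
    sequence.\<close>
  have "\<exists>x\<in>P. \<exists>N r. \<forall>y\<in>P. (\<forall>l<N. y l = x l) \<longrightarrow> y \<in> F (from_nat r)"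
  proof (rule sequence_space_Baire[OF closed_P closed_F nonempty])
    show "P \<subseteq> (\<Union>r. F (from_nat r))"
    proof
      fix x assume "x \<in> P"
      then obtain L where "x \<in> F L" using cover by blast
      then have "x \<in> F (from_nat (to_nat L))" by simp
      then show "x \<in> (\<Union>r. F (from_nat r))" by blast
    qed
  qed
  then obtain x N L where x: "x \<in> P" and box: "\<And>y. y \<in> P \<Longrightarrow> (\<forall>l<N. y l = x l) \<Longrightarrow> y \<in> F L" by blast
  have sZ: "\<And>j. strict_mono (Z j x)" and sE: "strict_mono (E x)"
    and inX: "\<And>l. E x l \<in> X (Z (l mod Suc n) x)" using x by (auto simp: P_def)
  \<comment> \<open>Pigeonhole: \<open>n + 1\<close> indices \<open>j\<close> select among
    \<open>n\<close> coordinates.\<close>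
  have "\<not> inj_on (\<lambda>j. fst (L ! j)) {..n}"
  proof
    assume inj: "inj_on (\<lambda>j. fst (L ! j)) {..n}"
    have "(\<lambda>j. fst (L ! j)) ` {..n} \<subseteq> {..<n}" using box[OF x] by (auto simp: F_def)
    from card_inj_on_le[OF inj this] show False by simp
  qed
  then obtain j j' where jj: "j \<le> n" "j' \<le> n" "j \<noteq> j'" "fst (L ! j) = fst (L ! j')"
    unfolding inj_on_def by blast
  \<comment> \<open>The first \<open>N\<close> values of \<open>E x\<close> are fixed by the box and
    must stay in \<open>X\<close> when a colouring is changed. For \<open>N = 0\<close> the maximum
    is over the empty set, but the claim is then vacuous.\<close>
  have X_stable: "\<exists>M. \<forall>z'. strict_mono z' \<longrightarrow> (\<forall>l<M. z' l = z l) \<longrightarrow> (\<forall>l<N. E x l \<in> X z' \<longleftrightarrow> E x l \<in> X z)"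
    if z: "strict_mono z" for z
  proof -
    obtain h where h: "\<And>m z'. strict_mono z' \<Longrightarrow> (\<forall>l<h m. z' l = z l) \<Longrightarrow> (m \<in> X z' \<longleftrightarrow> m \<in> X z)"
      using X_cont[OF z] by metis
    have "h (E x l) \<le> Max ((\<lambda>l. h (E x l)) ` {..<N})" if "l < N" for l
      using that by (intro Max_ge) auto
    then show ?thesis using h
      by (intro exI[of _ "Max ((\<lambda>l. h (E x l)) ` {..<N})"]) (meson order.strict_trans2)
  qed
  obtain M where M: "\<And>z'. strict_mono z' \<Longrightarrow> (\<forall>l<M. z' l = Z j x l) \<Longrightarrow>
      (\<forall>l<N. E x l \<in> X z' \<longleftrightarrow> E x l \<in> X (Z j x))" using X_stable[OF sZ] by blast
  obtain M' where M': "\<And>z'. strict_mono z' \<Longrightarrow> (\<forall>l<M'. z' l = Z j' x l) \<Longrightarrow>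
      (\<forall>l<N. E x l \<in> X z' \<longleftrightarrow> E x l \<in> X (Z j' x))" using X_stable[OF sZ] by blast
  \<comment> \<open>Agreement below \<open>N\<close> keeps the new sequences in the box; agreement
    below \<open>M\<close> and \<open>M'\<close> keeps the first \<open>N\<close> values of
    \<open>E x\<close> admissible.\<close>
  let ?B = "max N (max M M')"
  obtain w w' where w: "strict_mono w" "strict_mono w'" "\<forall>l<?B. w l = Z j x l" "\<forall>l<?B. w' l = Z j' x l"
    and fin: "finite {k. c w k = fst (snd (L ! j)) \<and> c w' k = fst (snd (L ! j'))}"
    using clash[OF sZ sZ] by blast
  define u where "u a = (if a = j then w else if a = j' then w' else Z a x)" for a
  have u_mono: "strict_mono (u a)" for a using w sZ by (simp add: u_def)
  have u_agree: "u a l = Z a x l" if "l < N" for a l using w that by (simp add: u_def)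
  have uX: "E x l \<in> X (u (l mod Suc n))" if "l < N" for l
  proof -
    have "E x l \<in> X w \<longleftrightarrow> E x l \<in> X (Z j x)" using M[OF w(1)] w(3) that by simp
    moreover have "E x l \<in> X w' \<longleftrightarrow> E x l \<in> X (Z j' x)" using M'[OF w(2)] w(4) that by simp
    ultimately show ?thesis using inX[of l] by (auto simp: u_def)
  qed
  \<comment> \<open>Beyond the box, \<open>e\<close> is rechosen inside the altered sets
    \<open>X (u a)\<close>, which brings the modified point back into \<open>P\<close>.\<close>
  obtain e where e: "strict_mono e" "\<And>l. l < N \<Longrightarrow> e l = E x l" "\<And>l. N \<le> l \<Longrightarrow> e l \<in> X (u (l mod Suc n))"
    using strict_mono_extension[OF sE, of "\<lambda>l. X (u (l mod Suc n))" N] X_inf[OF u_mono] by blast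
  define y where "y l = (\<lambda>a. u a l, e l)" for l
  have Zy: "Z a y = u a" for a by (simp add: Z_def y_def)
  have Ey: "E y = e" by (simp add: E_def y_def)
  have "e l \<in> X (u (l mod Suc n))" for l using uX e(2,3) by (metis not_le)
  then have "y \<in> P" using u_mono e(1) by (simp add: P_def Zy Ey)
  moreover have "\<forall>l<N. y l = x l"
    using u_agree e(2) by (simp add: y_def Z_def E_def prod_eq_iff)
  ultimately have yF: "y \<in> F L" by (rule box)
  have "infinite (C e (fst (L ! j)))" using yF jj(1) by (intro C_inf e) (auto simp: F_def)
  \<comment> \<open>Past both thresholds, points of the shared set have the colours that both labels
    demand; \<open>w\<close> and \<open>w'\<close> were chosen to leave only finitely many of
    these.\<close>
  moreover have "C e (fst (L ! j)) \<subseteq> {..max (snd (snd (L ! j))) (snd (snd (L ! j')))} \<union>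
      {k. c w k = fst (snd (L ! j)) \<and> c w' k = fst (snd (L ! j'))}"
  proof
    fix k assume k: "k \<in> C e (fst (L ! j))"
    have uj: "u j = w" "u j' = w'" using jj(3) by (auto simp: u_def)
    have "c w k = fst (snd (L ! j))" if "snd (snd (L ! j)) \<le> k"
      using yF jj(1) that k uj by (auto simp: F_def Zy Ey)
    moreover have "c w' k = fst (snd (L ! j'))" if "snd (snd (L ! j')) \<le> k"
      using yF jj(2,4) that k uj by (auto simp: F_def Zy Ey)
    ultimately show "k \<in> {..max (snd (snd (L ! j))) (snd (snd (L ! j')))} \<union>
      {k. c w k = fst (snd (L ! j)) \<and> c w' k = fst (snd (L ! j'))}" by auto
  qed
  ultimately show False using fin by (meson finite_UnI finite_atMost finite_subset)
qed

section \<open>Borel maps on infinite sets\<close>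

text \<open>Removing an element \<open>m\<close> from \<open>Z\<close> complements the colouring exactly on \<open>{m..}\<close>.\<close>

definition prefix_parity :: "nat set \<Rightarrow> nat \<Rightarrow> bool"
  where "prefix_parity Z k \<longleftrightarrow> even (card (Z \<inter> {..k}))"

text \<open>The number of smaller elements is the position in the increasing enumeration of
  \<open>Z\<close>. Outside \<open>{..<n + 1}\<close> the value is \<open>undefined\<close>, as
  membership in the product space demands.\<close>

definition residue_parts :: "nat \<Rightarrow> nat set \<Rightarrow> nat \<Rightarrow> nat set"
  where "residue_parts n Z = (\<lambda>j\<in>{..<n + 1}. {k \<in> Z. card (Z \<inter> {..<k}) mod Suc n = j})"

text \<open>A strictly increasing \<open>g\<close> satisfies \<open>l \<le> g l\<close>, so its
  values below \<open>N\<close> are taken at arguments below \<open>N\<close>.\<close>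

lemma range_Int_lessThan_cong:
  fixes g g' :: "nat \<Rightarrow> nat"
  assumes "strict_mono g" "strict_mono g'" "\<forall>l<N. g' l = g l"
  shows "range g' \<inter> {..<N} = range g \<inter> {..<N}"
proof -
  have below: "range f \<inter> {..<N} = f ` {..<N} \<inter> {..<N}" if "strict_mono f" for f :: "nat \<Rightarrow> nat"
    using strict_mono_imp_increasing[OF that] by (force intro: order.strict_trans1)
  have "g' ` {..<N} = g ` {..<N}" using assms(3) by (intro image_cong) auto
  then show ?thesis using below[OF assms(1)] below[OF assms(2)] by simp
qed

text \<open>From position \<open>N\<close> on, both sequences run through consecutive numbers, the
  second in step with the first or one ahead. The counts up to \<open>k\<close> then eventually
  agree or differ by exactly one, making the colourings equal or complementary.\<close>

lemma prefix_parity_clash: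
  fixes h z z' :: "nat \<Rightarrow> nat"
  assumes h: "strict_mono h" and z: "strict_mono z" "strict_mono z'"
  shows "\<exists>w w'. strict_mono w \<and> strict_mono w' \<and> (\<forall>l<N. w l = z l) \<and> (\<forall>l<N. w' l = z' l) \<and>
    finite {k. prefix_parity (range (h \<circ> w)) k = v \<and> prefix_parity (range (h \<circ> w')) k = v'}"
proof -
  \<comment> \<open>\<open>B\<close> bounds both values at \<open>N\<close>, so the spliced
    sequences stay increasing.\<close>
  define B where "B = max (z N) (z' N)"
  define ext where "ext x d l = (if l < N then x l else B + d + l)" for x :: "nat \<Rightarrow> nat" and d l :: nat
  have ext_mono: "strict_mono (ext x d)" if "strict_mono x" "x N \<le> B" for x d
    unfolding strict_mono_Suc_iff
  proof
    fix l
    have "x l < x N" if "l < N" using \<open>strict_mono x\<close> that by (simp add: strict_mono_def)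
    moreover have "x l < x (Suc l)" using \<open>strict_mono x\<close> by (simp add: strict_mono_def)
    ultimately show "ext x d l < ext x d (Suc l)"
      using \<open>x N \<le> B\<close> by (auto simp: ext_def)
  qed
  have card_range: "card (range g \<inter> {..k}) = card {l. g l \<le> k}" if "strict_mono g" for g :: "nat \<Rightarrow> nat" and k
  proof -
    have "range g \<inter> {..k} = g ` {l. g l \<le> k}" by auto
    then show ?thesis using strict_mono_imp_inj_on[OF that] by (simp add: card_image inj_on_subset)
  qed
  define T where "T d k = {l. N \<le> l \<and> h (B + d + l) \<le> k}" for d k
  have finT: "finite (T d k)" for d k
  proof (rule finite_subset[of _ "{..k}"])
    show "T d k \<subseteq> {..k}"
      using strict_mono_imp_increasing[OF h] by (auto simp: T_def) (meson add_leE order_trans)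
  qed simp
  have count: "card (range (h \<circ> ext x d) \<inter> {..k}) = N + card (T d k)"
    if x: "strict_mono x" "x N \<le> B" and k: "h (B + N) \<le> k" for x d k
  proof -
    have sm: "strict_mono (h \<circ> ext x d)" by (rule strict_mono_o[OF h ext_mono[OF x]])
    have "h (x l) \<le> k" if "l < N" for l
    proof -
      have "x l < x N" using x(1) that by (simp add: strict_mono_def)
      then have "x l \<le> B + N" using x(2) by linarith
      then show ?thesis using h k by (metis order_trans strict_mono_less_eq)
    qed
    then have "{l. (h \<circ> ext x d) l \<le> k} = {..<N} \<union> T d k"
      by (auto simp: ext_def T_def)
    moreover have "{..<N} \<inter> T d k = {}" by (auto simp: T_def)
    ultimately show ?thesis unfolding card_range[OF sm] by (simp add: card_Un_disjoint finT)
  qed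
  have shift: "card (T 0 k) = Suc (card (T 1 k))" if k: "h (B + N) \<le> k" for k
  proof -
    \<comment> \<open>The unshifted tail has at position \<open>l + 1\<close> the value of the
      shifted tail at \<open>l\<close>; only position \<open>N\<close> is extra.\<close>
    have "T 0 k = insert N (Suc ` T 1 k)"
    proof (intro equalityI subsetI)
      fix l assume l: "l \<in> T 0 k"
      show "l \<in> insert N (Suc ` T 1 k)"
      proof (cases "l = N")
        case False
        then have "l = Suc (l - 1)" "l - 1 \<in> T 1 k" using l by (auto simp: T_def)
        then show ?thesis by blast
      qed simp
    qed (use k in \<open>auto simp: T_def\<close>)
    moreover have "N \<notin> Suc ` T 1 k" by (auto simp: T_def)
    ultimately show ?thesis by (simp add: finT card_image)
  qed
  have zB: "z N \<le> B" "z' N \<le> B" by (auto simp: B_def)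
  \<comment> \<open>Complementary colourings miss an equal pair of colours, equal colourings an
    unequal pair.\<close>
  define d :: nat where "d = (if v = v' then 1 else 0)"
  have "\<not> (prefix_parity (range (h \<circ> ext z 0)) k = v \<and> prefix_parity (range (h \<circ> ext z' d)) k = v')"
    if k: "h (B + N) \<le> k" for k
    unfolding prefix_parity_def count[OF z(1) zB(1) k] count[OF z(2) zB(2) k]
    using shift[OF k] by (auto simp: d_def)
  then have "\<forall>k\<in>{k. prefix_parity (range (h \<circ> ext z 0)) k = v \<and> prefix_parity (range (h \<circ> ext z' d)) k = v'}.
      k < h (B + N)"
    using not_le by blast
  then have "finite {k. prefix_parity (range (h \<circ> ext z 0)) k = v \<and> prefix_parity (range (h \<circ> ext z' d)) k = v'}"
    unfolding finite_nat_set_iff_bounded by blast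
  then show ?thesis
    using ext_mono z zB by (intro exI[of _ "ext z 0"] exI[of _ "ext z' d"]) (auto simp: ext_def)
qed

lemma residue_parts_range:
  assumes e: "strict_mono e" and j: "j \<le> n"
  shows "residue_parts n (range e) j = e ` {l. l mod Suc n = j}"
proof -
  have "card (range e \<inter> {..<e l}) = l" for l
  proof -
    have "range e \<inter> {..<e l} = e ` {..<l}" using e by (auto simp: strict_mono_less)
    then show ?thesis using e by (simp add: card_image inj_on_subset strict_mono_imp_inj_on)
  qed
  then show ?thesis using j by (auto simp: residue_parts_def)
qed

lemma residue_parts_in_topspace:
  assumes "infinite Z"
  shows "residue_parts n Z \<in> topspace (infinite_sets_power (n + 1))"
proof -
  have e: "strict_mono (enumerate Z)" "range (enumerate Z) = Z"
    using assms by (simp_all add: strict_mono_enumerate range_enumerate)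
  have "infinite (residue_parts n Z j)" if j: "j \<le> n" for j
  proof -
    have "inj (\<lambda>q::nat. q * Suc n + j)" by (intro injI) (metis add_right_cancel mult_cancel2 nat.distinct(1))
    then have "infinite (range (\<lambda>q::nat. q * Suc n + j))" by (rule range_inj_infinite)
    moreover have "range (\<lambda>q. q * Suc n + j) \<subseteq> {l. l mod Suc n = j}"
      using j by (auto simp del: mult_Suc_right)
    ultimately have "infinite {l. l mod Suc n = j}" by (meson finite_subset)
    moreover have "inj_on (enumerate Z) {l. l mod Suc n = j}"
      by (rule strict_mono_imp_inj_on[OF e(1)])
    ultimately have "infinite (enumerate Z ` {l. l mod Suc n = j})" by (simp add: finite_image_iff)
    then show ?thesis using residue_parts_range[OF e(1) j] e(2) by simp
  qed
  then show ?thesis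
    by (auto simp: topspace_infinite_sets_power PiE_iff residue_parts_def less_Suc_eq_le)
qed

section \<open>Prefix neighbourhoods and preimages of Borel sets\<close>

lemma open_cantor_space_prefix:
  assumes "openin cantor_space U" "x \<in> U"
  shows "\<exists>N. \<forall>y. (\<forall>k<N. y k = x k) \<longrightarrow> y \<in> U"
proof -
  obtain V where V: "finite {i. V i \<noteq> UNIV}" "x \<in> Pi\<^sub>E UNIV V" "Pi\<^sub>E UNIV V \<subseteq> U"
    using assms(1)[unfolded cantor_space_def openin_product_topology_alt, rule_format, OF assms(2)]
    by auto
  obtain N where N: "\<forall>i\<in>{i. V i \<noteq> UNIV}. i < N" using V(1) unfolding finite_nat_set_iff_bounded by blast
  have "y \<in> Pi\<^sub>E UNIV V" if "\<forall>k<N. y k = x k" for y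
  proof -
    have "y i \<in> V i" for i
    proof (cases "V i = UNIV")
      case False
      then have "y i = x i" using that N by simp
      then show ?thesis using V(2) by auto
    qed simp
    then show ?thesis by auto
  qed
  then have "y \<in> U" if "\<forall>k<N. y k = x k" for y using V(3) that by (meson subsetD)
  then show ?thesis by (intro exI[of _ N]) simp
qed

lemma open_infinite_sets_prefix:
  assumes "openin infinite_sets V" "A \<in> V"
  shows "\<exists>N. \<forall>A'. infinite A' \<longrightarrow> A' \<inter> {..<N} = A \<inter> {..<N} \<longrightarrow> A' \<in> V"
proof -
  obtain U where U: "openin cantor_space U" "V = (\<lambda>A k. k \<in> A) -` U \<inter> {A. infinite A}"
    using assms(1) unfolding infinite_sets_def openin_pullback_topology by blast
  obtain N where N: "\<And>y. (\<forall>k<N. y k = (k \<in> A)) \<Longrightarrow> y \<in> U"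
    using open_cantor_space_prefix[OF U(1), of "\<lambda>k. k \<in> A"] assms(2) U(2) by auto
  have "A' \<in> V" if "infinite A'" "A' \<inter> {..<N} = A \<inter> {..<N}" for A'
  proof -
    have "(k \<in> A') = (k \<in> A)" if "k < N" for k
      using \<open>A' \<inter> {..<N} = A \<inter> {..<N}\<close> that by (metis Int_iff lessThan_iff)
    then show ?thesis using N[of "\<lambda>k. k \<in> A'"] U(2) that(1) by simp
  qed
  then show ?thesis by blast
qed

lemma open_infinite_sets_power_prefix:
  assumes "openin (infinite_sets_power m) U" "x \<in> U"
  shows "\<exists>N. \<forall>y\<in>topspace (infinite_sets_power m). (\<forall>j<m. y j \<inter> {..<N} = x j \<inter> {..<N}) \<longrightarrow> y \<in> U"
proof -
  obtain V where V: "\<And>i. i < m \<Longrightarrow> openin infinite_sets (V i)" "x \<in> Pi\<^sub>E {..<m} V" "Pi\<^sub>E {..<m} V \<subseteq> U"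
    using assms(1)[unfolded infinite_sets_power_def openin_product_topology_alt, rule_format, OF assms(2)]
    by (meson lessThan_iff)
  have "\<exists>N. \<forall>A'. infinite A' \<longrightarrow> A' \<inter> {..<N} = x i \<inter> {..<N} \<longrightarrow> A' \<in> V i" if "i < m" for i
    using open_infinite_sets_prefix[OF V(1)[OF that]] V(2) that by auto
  then obtain N where N: "\<And>i A'. i < m \<Longrightarrow> infinite A' \<Longrightarrow> A' \<inter> {..<N i} = x i \<inter> {..<N i} \<Longrightarrow> A' \<in> V i"
    by metis
  define M where "M = Max (N ` {..<m})"
  have M: "N i \<le> M" if "i < m" for i unfolding M_def using that by (intro Max_ge) auto
  show ?thesis
  proof (intro exI[of _ M] ballI impI)
    fix y assume y: "y \<in> topspace (infinite_sets_power m)" "\<forall>j<m. y j \<inter> {..<M} = x j \<inter> {..<M}"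
    have "y i \<in> V i" if "i < m" for i
    proof (rule N[OF that])
      show "infinite (y i)" using y(1) that by (auto simp: topspace_infinite_sets_power PiE_iff)
      have "y i \<inter> {..<M} \<inter> {..<N i} = x i \<inter> {..<M} \<inter> {..<N i}" using y(2) that by simp
      moreover have "{..<M} \<inter> {..<N i} = {..<N i}" using M[OF that] by auto
      ultimately show "y i \<inter> {..<N i} = x i \<inter> {..<N i}" by (simp add: Int_assoc)
    qed
    then have "y \<in> Pi\<^sub>E {..<m} V" using y(1) by (auto simp: topspace_infinite_sets_power PiE_iff)
    then show "y \<in> U" using V(3) by blast
  qed
qed

text \<open>The Galvin--Prikry theorem for preimages under a continuous map, by induction on the
  generation of \<open>V\<close>: open sets come from combinatorial forcing. Complements are
  relative to \<open>topspace X\<close>, which is where \<open>space\<close> enters.\<close>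

lemma completely_ramsey_vimage:
  assumes space: "\<And>Z. infinite Z \<Longrightarrow> f Z \<in> topspace X"
    and cont: "\<And>U. openin X U \<Longrightarrow> ramsey_open {Z. f Z \<in> U}"
    and V: "V \<in> sets (borel_of X)"
  shows "completely_ramsey {Z. f Z \<in> V}"
proof -
  have "V \<in> sigma_sets (topspace X) {U. openin X U}" using V by (simp add: sets_borel_of)
  then show ?thesis
  proof (induction V rule: sigma_sets.induct)
    case (Basic a)
    then show ?case using cont completely_ramsey_open by blast
  next
    case Empty
    then show ?case by (auto simp: completely_ramsey_def)
  next
    case (Compl a)
    have "completely_ramsey {Z. f Z \<in> topspace X - a} \<longleftrightarrow> completely_ramsey {Z. \<not> f Z \<in> a}"
      by (rule completely_ramsey_cong) (simp add: space)
    then show ?case using completely_ramsey_not[OF Compl.IH] by blast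
  next
    case (Union a)
    then show ?case using completely_ramsey_ex[of "\<lambda>i Z. f Z \<in> a i"] by simp
  qed
qed

lemma completely_ramsey_prefix_parity:
  assumes "V \<in> sets (borel_of cantor_space)"
  shows "completely_ramsey {Z. prefix_parity Z \<in> V}"
proof (rule completely_ramsey_vimage[OF _ _ assms])
  fix U assume U: "openin cantor_space U"
  show "ramsey_open {Z. prefix_parity Z \<in> U}"
    unfolding ramsey_open_def
  proof (intro allI impI)
    fix Z assume "Z \<in> {Z. prefix_parity Z \<in> U}"
    then obtain N where N: "\<And>y. (\<forall>k<N. y k = prefix_parity Z k) \<Longrightarrow> y \<in> U"
      using open_cantor_space_prefix[OF U, of "prefix_parity Z"] unfolding mem_Collect_eq by meson
    have "prefix_parity Z' k = prefix_parity Z k" if "Z' \<inter> {..<N} = Z \<inter> {..<N}" "k < N" for Z' k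
    proof -
      have "Z' \<inter> {..<N} \<inter> {..k} = Z \<inter> {..<N} \<inter> {..k}" using that(1) by simp
      moreover have "{..<N} \<inter> {..k} = {..k}" using that(2) by auto
      ultimately show ?thesis by (simp add: prefix_parity_def Int_assoc)
    qed
    then have "prefix_parity Z' \<in> U" if "Z' \<inter> {..<N} = Z \<inter> {..<N}" for Z'
      by (rule N[rule_format]) (rule that)
    then show "\<exists>N. \<forall>Z'. infinite Z' \<longrightarrow> Z' \<inter> {..<N} = Z \<inter> {..<N} \<longrightarrow> Z' \<in> {Z. prefix_parity Z \<in> U}"
      by (intro exI[of _ N]) simp
  qed
qed simp

lemma completely_ramsey_residue_parts:
  assumes "V \<in> sets (borel_of (infinite_sets_power (n + 1)))"
  shows "completely_ramsey {Z. residue_parts n Z \<in> V}"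
proof (rule completely_ramsey_vimage[OF residue_parts_in_topspace _ assms])
  fix U assume U: "openin (infinite_sets_power (n + 1)) U"
  show "ramsey_open {Z. residue_parts n Z \<in> U}"
    unfolding ramsey_open_def
  proof (intro allI impI)
    fix Z assume "Z \<in> {Z. residue_parts n Z \<in> U}"
    then obtain N where N: "\<And>y. y \<in> topspace (infinite_sets_power (n + 1)) \<Longrightarrow>
        (\<forall>j<n + 1. y j \<inter> {..<N} = residue_parts n Z j \<inter> {..<N}) \<Longrightarrow> y \<in> U"
      using open_infinite_sets_power_prefix[OF U, of "residue_parts n Z"] unfolding mem_Collect_eq by meson
    have "residue_parts n Z' j \<inter> {..<N} = residue_parts n Z j \<inter> {..<N}"
      if eq: "Z' \<inter> {..<N} = Z \<inter> {..<N}" and j: "j < n + 1" for Z' j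
    proof -
      have "Z' \<inter> {..<k} = Z \<inter> {..<k}" if "k < N" for k
      proof -
        have "Z' \<inter> {..<N} \<inter> {..<k} = Z \<inter> {..<N} \<inter> {..<k}" using eq by simp
        moreover have "{..<N} \<inter> {..<k} = {..<k}" using that by auto
        ultimately show ?thesis by (simp add: Int_assoc)
      qed
      moreover have "k \<in> Z' \<longleftrightarrow> k \<in> Z" if "k < N" for k
        using eq that by (metis Int_iff lessThan_iff)
      ultimately show ?thesis using j by (auto simp: residue_parts_def)
    qed
    then have "residue_parts n Z' \<in> U" if "infinite Z'" "Z' \<inter> {..<N} = Z \<inter> {..<N}" for Z'
      by (rule N[OF residue_parts_in_topspace[OF that(1)], rule_format]) (rule that(2))
    then show "\<exists>N. \<forall>Z'. infinite Z' \<longrightarrow> Z' \<inter> {..<N} = Z \<inter> {..<N} \<longrightarrow> Z' \<in> {Z. residue_parts n Z \<in> U}"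
      by (intro exI[of _ N]) simp
  qed
qed

section \<open>Passing from a Borel morphism to continuous data\<close>

theorem theorem4p2:
  fixes n :: nat
  assumes "n \<ge> 1"
  shows "\<not> (\<exists>(\<phi> :: (nat \<Rightarrow> nat set) \<Rightarrow> (nat \<Rightarrow> nat set)) (\<psi> :: (nat \<Rightarrow> bool) \<Rightarrow> (nat \<Rightarrow> bool)).
      \<phi> \<in> measurable (borel_of (infinite_sets_power (n + 1))) (borel_of (infinite_sets_power n)) \<and>
      \<psi> \<in> measurable (borel_of cantor_space) (borel_of cantor_space) \<and>
      (\<forall>A \<in> topspace (infinite_sets_power (n + 1)). \<forall>c \<in> topspace cantor_space.
         (\<forall>i<n. splits c (\<phi> A i)) \<longrightarrow> (\<forall>i<n + 1. splits (\<psi> c) (A i))))"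
proof (intro notI, elim exE conjE)
  fix \<phi> :: "(nat \<Rightarrow> nat set) \<Rightarrow> (nat \<Rightarrow> nat set)" and \<psi> :: "(nat \<Rightarrow> bool) \<Rightarrow> (nat \<Rightarrow> bool)"
  assume \<phi>: "\<phi> \<in> measurable (borel_of (infinite_sets_power (n + 1))) (borel_of (infinite_sets_power n))"
    and \<psi>: "\<psi> \<in> measurable (borel_of cantor_space) (borel_of cantor_space)"
    and morphism: "\<forall>A \<in> topspace (infinite_sets_power (n + 1)). \<forall>c \<in> topspace cantor_space.
         (\<forall>i<n. splits c (\<phi> A i)) \<longrightarrow> (\<forall>i<n + 1. splits (\<psi> c) (A i))"
  \<comment> \<open>Membership of \<open>k\<close> in coordinate \<open>i\<close> is an open
    condition. With \<open>i < n\<close> inside the set, the claim covers every pair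
    \<open>(i, k)\<close>, as the coding of pairs by numbers requires.\<close>
  have \<phi>_ramsey: "completely_ramsey {Z. i < n \<and> k \<in> \<phi> (residue_parts n Z) i}" for i k
  proof (cases "i < n")
    case True
    let ?V = "{A \<in> topspace (infinite_sets_power n). k \<in> A i}"
    have "openin infinite_sets {A \<in> topspace infinite_sets. k \<in> A}"
      unfolding infinite_sets_def openin_pullback_topology
    proof (intro exI conjI)
      have "openin cantor_space {c \<in> topspace cantor_space. c k \<in> {True}}"
        unfolding cantor_space_def
        by (rule openin_continuous_map_preimage[OF continuous_map_product_projection]) auto
      then show "openin cantor_space {c. c k}" by simp
    qed (auto simp flip: infinite_sets_def)
    then have "openin (infinite_sets_power n) {A \<in> topspace (infinite_sets_power n). A i \<in> {A \<in> topspace infinite_sets. k \<in> A}}"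
      unfolding infinite_sets_power_def using True
      by (intro openin_continuous_map_preimage[OF continuous_map_product_projection]) auto
    moreover have "{A \<in> topspace (infinite_sets_power n). A i \<in> {A \<in> topspace infinite_sets. k \<in> A}} = ?V"
      using True by (auto simp: topspace_infinite_sets_power PiE_iff)
    ultimately have "?V \<in> sets (borel_of (infinite_sets_power n))"
      by (simp add: sets_borel_of)
    from completely_ramsey_residue_parts[OF measurable_sets[OF \<phi> this]]
    have "completely_ramsey {Z. residue_parts n Z \<in> \<phi> -` ?V \<inter> topspace (infinite_sets_power (n + 1))}"
      by (simp only: space_borel_of)
    also have "?this \<longleftrightarrow> completely_ramsey {Z. i < n \<and> k \<in> \<phi> (residue_parts n Z) i}"
    proof (rule completely_ramsey_cong)
      fix Z :: "nat set" assume "infinite Z"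
      then have Z: "residue_parts n Z \<in> topspace (infinite_sets_power (n + 1))"
        by (rule residue_parts_in_topspace)
      then have "\<phi> (residue_parts n Z) \<in> topspace (infinite_sets_power n)"
        using measurable_space[OF \<phi>] by simp
      then show "Z \<in> {Z. residue_parts n Z \<in> \<phi> -` ?V \<inter> topspace (infinite_sets_power (n + 1))} \<longleftrightarrow>
          Z \<in> {Z. i < n \<and> k \<in> \<phi> (residue_parts n Z) i}"
        using Z True by blast
    qed
    finally show ?thesis .
  qed (auto simp: completely_ramsey_def)
  have \<psi>_ramsey: "completely_ramsey {Z. \<psi> (prefix_parity Z) m}" for m
  proof -
    have "openin cantor_space {c \<in> topspace cantor_space. c m \<in> {True}}"
      unfolding cantor_space_def
      by (rule openin_continuous_map_preimage[OF continuous_map_product_projection]) auto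
    then have "{c. c m} \<in> sets (borel_of cantor_space)"
      by (auto simp: sets_borel_of)
    from completely_ramsey_prefix_parity[OF measurable_sets[OF \<psi> this]]
    show ?thesis by simp
  qed

  \<comment> \<open>One number \<open>m\<close> codes a pair \<open>(i, k)\<close>, so a single
    \<open>Y\<close> makes all coordinates of \<open>\<phi>\<close> continuous.\<close>
  define S where "S m = {Z. fst (prod_decode m) < n \<and>
      snd (prod_decode m) \<in> \<phi> (residue_parts n Z) (fst (prod_decode m))}" for m
  have "completely_ramsey (S m)" for m
    unfolding S_def by (rule \<phi>_ramsey)
  then obtain Y where Y: "infinite Y" and Y_cont: "\<And>m. \<exists>N. \<forall>Z Z'. Z \<subseteq> Y \<longrightarrow> Z' \<subseteq> Y \<longrightarrow>
      infinite Z \<longrightarrow> infinite Z' \<longrightarrow> Z \<inter> {..<N} = Z' \<inter> {..<N} \<longrightarrow> (Z \<in> S m \<longleftrightarrow> Z' \<in> S m)"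
    using completely_ramsey_continuity[of S, OF _ infinite_UNIV_nat] by blast
  have \<phi>_cont: "\<exists>N. \<forall>Z Z'. Z \<subseteq> Y \<longrightarrow> Z' \<subseteq> Y \<longrightarrow> infinite Z \<longrightarrow> infinite Z' \<longrightarrow>
      Z \<inter> {..<N} = Z' \<inter> {..<N} \<longrightarrow> (k \<in> \<phi> (residue_parts n Z) i \<longleftrightarrow> k \<in> \<phi> (residue_parts n Z') i)"
    if "i < n" for i k
    using Y_cont[of "prod_encode (i, k)"] that by (simp add: S_def)
  define y where "y = enumerate Y"
  have y: "strict_mono y" "range y = Y"
    using Y by (simp_all add: y_def strict_mono_enumerate range_enumerate)

  \<comment> \<open>Infinitude is a countable combination of completely Ramsey conditions: beyond
    every \<open>a\<close> there is some \<open>m\<close>.\<close>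
  have "completely_ramsey {Z. m > a \<and> \<psi> (prefix_parity Z) (y m)}" for a m
    using \<psi>_ramsey[of "y m"] by (cases "m > a") (auto simp: completely_ramsey_def)
  then have "completely_ramsey {Z. \<forall>a. \<exists>m. m > a \<and> \<psi> (prefix_parity Z) (y m)}"
    by (intro completely_ramsey_all completely_ramsey_ex)
  then have inf_ramsey: "completely_ramsey {Z. infinite {m. \<psi> (prefix_parity Z) (y m)}}"
    by (simp add: infinite_nat_iff_unbounded)
  \<comment> \<open>On subsets of \<open>H0\<close>, \<open>True\<close> occurs along
    \<open>y\<close> either always infinitely often or always finitely often; in the second case
    \<open>False\<close> can serve as \<open>b\<close>.\<close>
  obtain H0 where H0: "infinite H0" and
    "(\<forall>Z\<subseteq>H0. infinite Z \<longrightarrow> infinite {m. \<psi> (prefix_parity Z) (y m) = True}) \<or>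
     (\<forall>Z\<subseteq>H0. infinite Z \<longrightarrow> \<not> infinite {m. \<psi> (prefix_parity Z) (y m)})"
    using inf_ramsey[unfolded completely_ramsey_def, rule_format, OF finite.emptyI infinite_UNIV_nat] by auto
  moreover have "infinite {m. \<psi> c (y m) = False}" if "\<not> infinite {m. \<psi> c (y m)}" for c
  proof -
    have "{m. \<psi> c (y m) = False} = - {m. \<psi> c (y m)}" by auto
    then show ?thesis using that by (metis finite_compl infinite_UNIV_nat)
  qed
  ultimately have "\<exists>b. \<forall>Z\<subseteq>H0. infinite Z \<longrightarrow> infinite {m. \<psi> (prefix_parity Z) (y m) = b}"
    by blast
  then obtain b where b: "\<And>Z. Z \<subseteq> H0 \<Longrightarrow> infinite Z \<Longrightarrow> infinite {m. \<psi> (prefix_parity Z) (y m) = b}"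
    by blast
  obtain H where H: "H \<subseteq> H0" "infinite H" and \<psi>_cont: "\<And>m. \<exists>N. \<forall>Z Z'. Z \<subseteq> H \<longrightarrow> Z' \<subseteq> H \<longrightarrow>
      infinite Z \<longrightarrow> infinite Z' \<longrightarrow> Z \<inter> {..<N} = Z' \<inter> {..<N} \<longrightarrow>
      (\<psi> (prefix_parity Z) m \<longleftrightarrow> \<psi> (prefix_parity Z') m)"
    using completely_ramsey_continuity[of "\<lambda>m. {Z. \<psi> (prefix_parity Z) m}", OF \<psi>_ramsey H0]
    unfolding mem_Collect_eq by meson
  define h where "h = enumerate H"
  have h: "strict_mono h" "range h = H"
    using H(2) by (simp_all add: h_def strict_mono_enumerate range_enumerate)

  have infinite_range: "infinite (range g)" if "strict_mono g" for g :: "nat \<Rightarrow> nat"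
    using that by (simp add: range_inj_infinite strict_mono_imp_inj_on)
  have comp: "strict_mono (f \<circ> g)" "range (f \<circ> g) \<subseteq> range f" "infinite (range (f \<circ> g))"
    if "strict_mono f" "strict_mono g" for f g :: "nat \<Rightarrow> nat"
    using strict_mono_o[OF that] infinite_range[OF strict_mono_o[OF that]] by auto
  define c where "c z = prefix_parity (range (h \<circ> z))" for z :: "nat \<Rightarrow> nat"
  \<comment> \<open>\<open>X z\<close> consists of indices into \<open>y\<close>, so
    \<open>e l \<in> X z\<close> says that the element \<open>y (e l)\<close> of \<open>Y\<close>
    gets colour \<open>b\<close>.\<close>
  define X where "X z = {m. \<psi> (c z) (y m) = b}" for z :: "nat \<Rightarrow> nat"
  define C where "C e = \<phi> (residue_parts n (range (y \<circ> e)))" for e :: "nat \<Rightarrow> nat"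
  show False
  proof (rule no_continuous_splitting[of n C c X])
    fix e :: "nat \<Rightarrow> nat" and i k
    assume e: "strict_mono e" and i: "i < n"
    have "C e \<in> topspace (infinite_sets_power n)"
      unfolding C_def using measurable_space[OF \<phi>] residue_parts_in_topspace[OF comp(3)[OF y(1) e]] by simp
    then show "infinite (C e i)" using i by (auto simp: topspace_infinite_sets_power PiE_iff)
    assume k: "k \<in> C e i"
    obtain N where N: "\<And>Z Z'. Z \<subseteq> Y \<Longrightarrow> Z' \<subseteq> Y \<Longrightarrow> infinite Z \<Longrightarrow> infinite Z' \<Longrightarrow>
        Z \<inter> {..<N} = Z' \<inter> {..<N} \<Longrightarrow> (k \<in> \<phi> (residue_parts n Z) i \<longleftrightarrow> k \<in> \<phi> (residue_parts n Z') i)"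
      using \<phi>_cont[OF i] by meson
    have "k \<in> C e' i" if e': "strict_mono e'" "\<forall>l<N. e' l = e l" for e'
    proof -
      have "range (y \<circ> e') \<inter> {..<N} = range (y \<circ> e) \<inter> {..<N}"
        using e' by (intro range_Int_lessThan_cong comp y e) auto
      then show ?thesis
        using N[of "range (y \<circ> e')" "range (y \<circ> e)"] comp[OF y(1) e] comp[OF y(1) e'(1)] y(2) k
        by (simp add: C_def)
    qed
    then show "\<exists>N. \<forall>e'. strict_mono e' \<longrightarrow> (\<forall>l<N. e' l = e l) \<longrightarrow> k \<in> C e' i" by blast
  next
    fix z :: "nat \<Rightarrow> nat" and k assume z: "strict_mono z"
    have "c z' k = c z k" if z': "strict_mono z'" "\<forall>l<Suc k. z' l = z l" for z'
    proof -
      have "range (h \<circ> z') \<inter> {..<Suc k} = range (h \<circ> z) \<inter> {..<Suc k}"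
        using z' by (intro range_Int_lessThan_cong comp h z) auto
      then show ?thesis by (simp add: c_def prefix_parity_def lessThan_Suc_atMost)
    qed
    then show "\<exists>N. \<forall>z'. strict_mono z' \<longrightarrow> (\<forall>l<N. z' l = z l) \<longrightarrow> c z' k = c z k" by blast
  next
    fix z :: "nat \<Rightarrow> nat" and m assume z: "strict_mono z"
    show "infinite (X z)"
      unfolding X_def c_def using b comp[OF h(1) z] h(2) H(1) by (meson subset_trans)
    obtain N where N: "\<And>Z Z'. Z \<subseteq> H \<Longrightarrow> Z' \<subseteq> H \<Longrightarrow> infinite Z \<Longrightarrow> infinite Z' \<Longrightarrow>
        Z \<inter> {..<N} = Z' \<inter> {..<N} \<Longrightarrow> (\<psi> (prefix_parity Z) (y m) \<longleftrightarrow> \<psi> (prefix_parity Z') (y m))"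
      using \<psi>_cont by meson
    have "m \<in> X z' \<longleftrightarrow> m \<in> X z" if z': "strict_mono z'" "\<forall>l<N. z' l = z l" for z'
    proof -
      have "range (h \<circ> z') \<inter> {..<N} = range (h \<circ> z) \<inter> {..<N}"
        using z' by (intro range_Int_lessThan_cong comp h z) auto
      then show ?thesis
        using N[of "range (h \<circ> z')" "range (h \<circ> z)"] comp[OF h(1) z] comp[OF h(1) z'(1)] h(2)
        by (simp add: X_def c_def)
    qed
    then show "\<exists>N. \<forall>z'. strict_mono z' \<longrightarrow> (\<forall>l<N. z' l = z l) \<longrightarrow> (m \<in> X z' \<longleftrightarrow> m \<in> X z)" by blast
  next
    fix z e :: "nat \<Rightarrow> nat" and j
    assume z: "strict_mono z" and e: "strict_mono e" and j: "j \<le> n"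
      and inX: "\<And>l. l mod Suc n = j \<Longrightarrow> e l \<in> X z"
    let ?A = "residue_parts n (range (y \<circ> e))"
    have "?A j = (y \<circ> e) ` {l. l mod Suc n = j}"
      by (rule residue_parts_range[OF comp(1)[OF y(1) e] j])
    \<comment> \<open>The \<open>j\<close>-th part is monochromatic, so the morphism property forces
      \<open>c z\<close> not to split some coordinate.\<close>
    then have "\<psi> (c z) k = b" if "k \<in> ?A j" for k using that inX by (auto simp: X_def)
    then have "{k \<in> ?A j. \<psi> (c z) k} = {} \<or> {k \<in> ?A j. \<not> \<psi> (c z) k} = {}" by blast
    then have "\<not> splits (\<psi> (c z)) (?A j)" unfolding splits_def by (metis finite.emptyI)
    moreover have "?A \<in> topspace (infinite_sets_power (n + 1))"
      by (rule residue_parts_in_topspace[OF comp(3)[OF y(1) e]])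
    ultimately show "\<exists>i<n. \<not> splits (c z) (C e i)"
      using morphism[rule_format, of ?A "c z" j] j by (auto simp: C_def)
  next
    fix z z' :: "nat \<Rightarrow> nat" and N v v' assume "strict_mono z" "strict_mono z'"
    then show "\<exists>w w'. strict_mono w \<and> strict_mono w' \<and> (\<forall>l<N. w l = z l) \<and> (\<forall>l<N. w' l = z' l) \<and>
        finite {k. c w k = v \<and> c w' k = v'}"
      unfolding c_def by (rule prefix_parity_clash[OF h(1)])
  qed
qed

end
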